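(* Let $A=(A_{ij})$, $B=(B_{ij})$ be $m\times n$ matrices with entries in $\mathbb{R}\cup\{-\infty\}$ such that for every $j\in[n]$ there exists $i\in[m]$ with $A_{ij}\neq-\infty$, and for every $i\in[m]$ there exists $j\in[n]$ with $B_{ij}\neq-\infty$. Let $f=A^\sharp B$ be the dynamic programming operator of the associated mean payoff game, i.e. $f_j(x)=\min_{i\in[m]}\bigl(-A_{ij}+\max_{k\in[n]}(B_{ik}+x_k)\bigr)$. Then, for every $r\in[n]$ and $\lambda\in\mathbb{R}$, the inequality $\chi_r(f)\geq\lambda$ holds if and only if the following tropical polyhedron is non-empty: $$P_r:=\Bigl\{y\in(\mathbb{R}\cup\{-\infty\})^J:\lambda+\max\bigl(\max_{j\in J}(A_{ij}+y_j),A_{ir}\bigr)\leq\max\bigl(\max_{j\in J}(B_{ij}+y_j),B_{ir}\bigr)\ \ \forall i\in[m]\Bigr\},$$ where $J:=[n]\setminus\{r\}$.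
   Context: Write $[n]=\{1,\dots,n\}$. In the definition of $f$ the convention is $(+\infty)+(-\infty)=+\infty$ (indices $i$ with $A_{ij}=-\infty$ do not contribute). Under the stated assumptions $f$ maps $\mathbb{R}^n$ to itself and $\chi(f):=\lim_{N\to\infty}f^N(0)/N\in\mathbb{R}^n$ exists, where $f^N$ is the $N$-th iterate; $\chi_r(f)$ is its $r$-th coordinate. Game interpretation: players Max and Min alternate moves on the disjoint union of $[m]$ and $[n]$; in state $j\in[n]$, Min chooses $i\in[m]$ with $A_{ij}\neq-\infty$, moves to $i$ and receives $A_{ij}$ from Max; in state $i\in[m]$, Max chooses $j\in[n]$ with $B_{ij}\neq-\infty$, moves to $j$ and receives $B_{ij}$ from Min. $\chi_r(f)$ is the value for Max of the mean payoff game starting from $r$. *)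

theory Defs
  imports "HOL-Analysis.Analysis"
begin

text \<open>
  The tropical (max-plus) semiring \<open>\<real> \<union> {-\<infinity>}\<close>. Indices range over finite types, which are nonempty,
  so \<open>ereal ^ 'n ^ 'm\<close> stands for the \<open>m \<times> n\<close> matrices with \<open>m, n \<ge> 1\<close>.
\<close>

definition trop :: "ereal set" where
  "trop = {x. x \<noteq> \<infinity>}"

text \<open>
  On \<^typ>\<open>ereal\<close> the library already has \<open>\<infinity> + (-\<infinity>) = \<infinity>\<close>, the convention needed for \<open>A\<^sup>\<sharp>\<close>.
  The coercion to \<^typ>\<open>real\<close> discards nothing under the standing assumptions on \<open>A\<close> and \<open>B\<close>:
  see \<open>ereal_dp_op\<close> below.
\<close>

definition dp_op :: "ereal ^ 'n ^ 'm \<Rightarrow> ereal ^ 'n ^ 'm \<Rightarrow> real ^ 'n \<Rightarrow> real ^ 'n" where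
  "dp_op A B x =
     (\<chi> j. real_of_ereal (INF i. - (A $ i $ j) + (SUP k. B $ i $ k + ereal (x $ k))))"

definition escape_rate :: "(real ^ 'n \<Rightarrow> real ^ 'n) \<Rightarrow> real ^ 'n" where
  "escape_rate f = lim (\<lambda>N. (1 / real N) *\<^sub>R (f ^^ N) 0)"

text \<open>
  Vectors indexed by \<open>J = - {r}\<close> are extensional functions. If \<open>J\<close> is empty, the supremum over \<open>J\<close>
  is \<open>-\<infinity>\<close>, the tropical zero.
\<close>

definition trop_polyhedron ::
  "ereal ^ 'n ^ 'm \<Rightarrow> ereal ^ 'n ^ 'm \<Rightarrow> real \<Rightarrow> 'n \<Rightarrow> ('n \<Rightarrow> ereal) set" where
  "trop_polyhedron A B l r =
     {y \<in> (- {r}) \<rightarrow>\<^sub>E trop. \<forall>i.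
        ereal l + max (SUP j \<in> - {r}. A $ i $ j + y j) (A $ i $ r)
        \<le> max (SUP j \<in> - {r}. B $ i $ j + y j) (B $ i $ r)}"

lemma ereal_dp_op:
  fixes A B :: "ereal ^ 'n ^ 'm"
  assumes A: "\<And>i j. A $ i $ j \<in> trop" and B: "\<And>i j. B $ i $ j \<in> trop"
    and colA: "\<And>j. \<exists>i. A $ i $ j \<noteq> -\<infinity>" and rowB: "\<And>i. \<exists>j. B $ i $ j \<noteq> -\<infinity>"
  shows "ereal (dp_op A B x $ j) =
    (INF i. - (A $ i $ j) + (SUP k. B $ i $ k + ereal (x $ k)))"
proof -
  let ?s = "\<lambda>i. SUP k. B $ i $ k + ereal (x $ k)"
  let ?g = "\<lambda>i. - (A $ i $ j) + ?s i"
  have s: "?s i \<noteq> \<infinity> \<and> ?s i \<noteq> -\<infinity>" for i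
  proof
    have "?s i \<in> range (\<lambda>k. B $ i $ k + ereal (x $ k))"
      by (subst cSup_eq_Max) (auto intro!: Max_in)
    then show "?s i \<noteq> \<infinity>" using B by (auto simp: trop_def)
    obtain k where "B $ i $ k \<noteq> -\<infinity>" using rowB by blast
    then have "-\<infinity> < B $ i $ k + ereal (x $ k)" by (cases "B $ i $ k") auto
    also have "\<dots> \<le> ?s i" by (rule SUP_upper) simp
    finally show "?s i \<noteq> -\<infinity>" by simp
  qed
  have "(INF i. ?g i) \<in> range ?g"
    by (subst cInf_eq_Min) (auto intro!: Min_in)
  then obtain i where i: "(INF i. ?g i) = ?g i" by auto
  have "?g i \<noteq> -\<infinity>"
    using s[of i] A[of i j] by (cases "A $ i $ j"; cases "?s i") (auto simp: trop_def)
  moreover obtain i' where "A $ i' $ j \<noteq> -\<infinity>" using colA by blast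
  then have "?g i' \<noteq> \<infinity>"
    using s[of i'] A[of i' j] by (cases "A $ i' $ j"; cases "?s i'") (auto simp: trop_def)
  moreover have "(INF i. ?g i) \<le> ?g i'" by (rule INF_lower) simp
  ultimately have "\<bar>INF i. ?g i\<bar> \<noteq> \<infinity>"
    unfolding i by auto
  then show ?thesis by (simp add: dp_op_def ereal_real')
qed

end

theory Submission
  imports Defs
begin

text \<open>
  Write \<open>f\<close> for the dynamic programming operator. A point of the polyhedron, completed by \<open>y\<^sub>r = 0\<close>,
  is the same as a vector \<open>y\<close> over \<open>\<real> \<union> {-\<infinity>}\<close> with \<open>y\<^sub>r\<close> finite and \<open>\<lambda> + y \<le> f(y)\<close>, where \<open>f\<close> is extended
  to infinite entries: each linear inequality says that, from row \<open>i\<close>, Max has an answer to every move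
  of Min into \<open>i\<close>. Such a \<open>y\<close> is recorded below by its support \<open>S\<close> and its finite values \<open>v\<close>, as a
  \<open>subsolution\<close>. Hence the claim is that the rate of \<open>f\<^sup>N(0)\<close> at \<open>r\<close> is at least \<open>\<lambda>\<close> if and only if some
  subsolution at level \<open>\<lambda>\<close> has \<open>r\<close> in its support.

  If a subsolution exists, monotonicity and commutation of \<open>f\<close> with constants give
  \<open>f\<^sup>N(0)\<^sub>r \<ge> N \<lambda> - C\<close> by iteration (\<open>subsolution_lower_bound\<close>).

  If none exists, normalise \<open>\<lambda>\<close> to \<open>0\<close> and let Min stop whenever that is profitable, that is, iterate
  \<open>x \<mapsto> min(0, f(x))\<close> from \<open>0\<close>. The iterates decrease, and their limit is a subsolution supported on the
  set where they stay bounded. So \<open>r\<close> lies in the complement \<open>T\<close> of this set, and on \<open>T\<close> Min can win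
  any amount in bounded time, in fact without letting Max leave \<open>T\<close> (\<open>stop_confined\<close>). Repeating such
  rounds makes an upper bound for \<open>f\<^sup>N(0)\<close> on \<open>T\<close> fall by \<open>1\<close> every \<open>p\<close> steps, for some fixed \<open>p\<close>, whence
  \<open>f\<^sup>N(0)\<^sub>r \<le> C + N (\<lambda> - \<epsilon>)\<close> for some \<open>\<epsilon> > 0\<close> (\<open>negative_drift\<close>, \<open>no_subsolution_upper_bound\<close>).

  The two bounds also prove that the limit exists: the lower and upper limits of \<open>f\<^sup>N(0)\<^sub>r / N\<close> equal the
  supremum of the levels of subsolutions at \<open>r\<close>. The gain of \<open>\<epsilon>\<close> in the upper bound shows that
  the supremum is itself such a level, which settles the equivalence in the boundary case.
\<close>

section \<open>Operators of deterministic mean payoff games\<close>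

text \<open>
  Matrix entries \<open>-\<infinity>\<close> become missing edges of the relations \<open>EA\<close> and \<open>EB\<close>, which leaves real weights
  \<open>a\<close> and \<open>b\<close>. The two assumptions together say that \<open>f x $ j\<close> is the minimum over the edges to \<open>i\<close>
  of \<open>- a i j + max\<^sub>k (b i k + x $ k)\<close>: the first that some \<open>i\<close> achieves this value or less, the second
  that no \<open>i\<close> yields less.
\<close>

locale game_operator =
  fixes EA EB :: "'m::finite \<Rightarrow> 'n::finite \<Rightarrow> bool"
    and a b :: "'m \<Rightarrow> 'n \<Rightarrow> real"
    and f :: "real ^ 'n \<Rightarrow> real ^ 'n"
  assumes min_move: "\<exists>i. EA i j \<and> (\<forall>k. EB i k \<longrightarrow> b i k + x $ k \<le> f x $ j + a i j)"
    and max_move: "EA i j \<Longrightarrow> \<exists>k. EB i k \<and> f x $ j + a i j \<le> b i k + x $ k"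
begin

lemma le_operatorI:
  assumes "\<And>i. EA i j \<Longrightarrow> \<exists>k. EB i k \<and> c + a i j \<le> b i k + x $ k"
  shows "c \<le> f x $ j"
proof -
  obtain i where i: "EA i j" "\<And>k. EB i k \<Longrightarrow> b i k + x $ k \<le> f x $ j + a i j"
    using min_move by blast
  obtain k where "EB i k" "c + a i j \<le> b i k + x $ k"
    using assms[OF i(1)] by blast
  with i(2)[of k] show ?thesis by simp
qed

lemma operator_mono_shift:
  assumes "\<And>k. x $ k \<le> c + y $ k"
  shows "f x $ j \<le> c + f y $ j"
proof -
  have "f x $ j - c \<le> f y $ j"
  proof (rule le_operatorI)
    fix i assume "EA i j"
    then obtain k where "EB i k" "f x $ j + a i j \<le> b i k + x $ k"
      using max_move by blast
    with assms[of k] show "\<exists>k. EB i k \<and> f x $ j - c + a i j \<le> b i k + y $ k"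
      by (intro exI[of _ k]) auto
  qed
  then show ?thesis by simp
qed

lemma operator_diff_const: "f (x - vec c) = f x - vec c"
proof (rule vec_eq_iff[THEN iffD2], rule allI)
  fix j
  have "f (x - vec c) $ j \<le> - c + f x $ j" by (rule operator_mono_shift) simp
  moreover have "f x $ j \<le> c + f (x - vec c) $ j" by (rule operator_mono_shift) simp
  ultimately show "f (x - vec c) $ j = (f x - vec c) $ j" by simp
qed

text \<open>
  This is \<open>l + y \<le> f(y)\<close> for the vector \<open>y\<close> that equals \<open>v\<close> on \<open>S\<close> and \<open>-\<infinity>\<close> elsewhere; a move of
  Max out of \<open>S\<close> is worth \<open>-\<infinity>\<close> and therefore cannot serve as an answer.
\<close>

definition subsolution :: "real \<Rightarrow> 'n set \<Rightarrow> ('n \<Rightarrow> real) \<Rightarrow> bool" where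
  "subsolution l S v \<longleftrightarrow>
     (\<forall>j\<in>S. \<forall>i. EA i j \<longrightarrow> (\<exists>k\<in>S. EB i k \<and> l + v j + a i j \<le> b i k + v k))"

lemma subsolution_le_operator:
  assumes sub: "subsolution l S v" and x: "\<And>k. k \<in> S \<Longrightarrow> v k + c \<le> x $ k" and j: "j \<in> S"
  shows "l + v j + c \<le> f x $ j"
proof (rule le_operatorI)
  fix i assume "EA i j"
  then obtain k where "k \<in> S" "EB i k" "l + v j + a i j \<le> b i k + v k"
    using sub j unfolding subsolution_def by blast
  with x[of k] show "\<exists>k. EB i k \<and> l + v j + c + a i j \<le> b i k + x $ k"
    by (intro exI[of _ k]) auto
qed

text \<open>
  The vector \<open>v\<close>, shifted down below \<open>0\<close>, stays below the iterates and gains \<open>l\<close> in each step.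
\<close>

lemma subsolution_lower_bound:
  assumes sub: "subsolution l S v" and j: "j \<in> S"
  shows "\<exists>C. \<forall>N. real N * l - C \<le> (f ^^ N) 0 $ j"
proof -
  define K where "K = Max (range v)"
  have K: "v k \<le> K" for k unfolding K_def by (intro Max_ge) auto
  have *: "v k + (real N * l - K) \<le> (f ^^ N) 0 $ k" if "k \<in> S" for N k
    using that
  proof (induction N arbitrary: k)
    case 0
    then show ?case using K[of k] by simp
  next
    case (Suc N)
    have "l + v k + (real N * l - K) \<le> f ((f ^^ N) 0) $ k"
      using sub Suc by (intro subsolution_le_operator) auto
    then show ?case by (simp add: algebra_simps)
  qed
  show ?thesis
  proof (intro exI allI)
    fix N
    show "real N * l - (K - v j) \<le> (f ^^ N) 0 $ j" using *[OF j, of N] by simp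
  qed
qed

section \<open>The game in which Min may stop\<close>

text \<open>
  \<open>stop u N $ j\<close> is the value of the game of at most \<open>N\<close> rounds from \<open>j\<close> in which Min, at each of his
  turns, may end the game with the additional payment \<open>u $ k\<close> to Max at the current state \<open>k\<close>.
\<close>

primrec stop :: "real ^ 'n \<Rightarrow> nat \<Rightarrow> real ^ 'n" where
  "stop u 0 = u"
| "stop u (Suc N) = (\<chi> j. min (u $ j) (f (stop u N) $ j))"

lemma stop_shift_mono:
  assumes "\<And>k. u $ k \<le> c + w $ k"
  shows "stop u N $ j \<le> c + stop w N $ j"
proof (induction N arbitrary: j)
  case (Suc N)
  have "f (stop u N) $ j \<le> c + f (stop w N) $ j" by (rule operator_mono_shift) (rule Suc)
  with assms[of j] show ?case by auto
qed (use assms in simp)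

lemma stop_Suc_le: "stop u (Suc N) $ j \<le> stop u N $ j"
proof (induction N arbitrary: j)
  case (Suc N)
  have "f (stop u (Suc N)) $ j \<le> 0 + f (stop u N) $ j"
    by (rule operator_mono_shift) (use Suc in simp)
  then show ?case by auto
qed simp

lemma stop_antimono: "M \<le> N \<Longrightarrow> stop u N $ j \<le> stop u M $ j"
  by (rule lift_Suc_antimono_le[of "\<lambda>N. stop u N $ j"]) (use stop_Suc_le in auto)

definition stop_bounded :: "'n set" where
  "stop_bounded = {j. bdd_below (range (\<lambda>N. stop 0 N $ j))}"

definition stop_limit :: "'n \<Rightarrow> real" where
  "stop_limit j = (INF N. stop 0 N $ j)"

lemma stop_limit_le: "j \<in> stop_bounded \<Longrightarrow> stop_limit j \<le> stop 0 N $ j"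
  unfolding stop_limit_def stop_bounded_def by (rule cINF_lower) auto

text \<open>
  Passing to the limit in \<open>stop 0 (N + 1) \<le> f (stop 0 N)\<close>: on the states with finite limit, the limit is
  a subsolution at level \<open>0\<close>.
\<close>

lemma subsolution_stop_limit: "subsolution 0 stop_bounded stop_limit"
  unfolding subsolution_def
proof (intro ballI allI impI)
  fix j i assume j: "j \<in> stop_bounded" and i: "EA i j"
  define c where "c = stop_limit j + a i j"
  have ex: "\<exists>k. EB i k \<and> c - b i k \<le> stop 0 N $ k" for N
  proof -
    obtain k where k: "EB i k" "f (stop 0 N) $ j + a i j \<le> b i k + stop 0 N $ k"
      using max_move[OF i] by blast
    moreover have "stop_limit j \<le> f (stop 0 N) $ j"
      using stop_limit_le[OF j, of "Suc N"] by simp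
    ultimately show ?thesis by (intro exI[of _ k]) (auto simp: c_def)
  qed
  \<comment> \<open>One answer of Max serves for all horizons: the values decrease, so an answer that fails
    at some horizon fails at all later ones, and there are finitely many answers.\<close>
  have "\<exists>k. EB i k \<and> (\<forall>N. c - b i k \<le> stop 0 N $ k)"
  proof (rule ccontr)
    assume "\<nexists>k. EB i k \<and> (\<forall>N. c - b i k \<le> stop 0 N $ k)"
    then obtain n where n: "\<And>k. EB i k \<Longrightarrow> stop 0 (n k) $ k < c - b i k"
      by (metis not_le)
    define M where "M = Max (range n)"
    have "n k \<le> M" for k unfolding M_def by (intro Max_ge) auto
    then have "stop 0 M $ k < c - b i k" if "EB i k" for k
      using n[OF that] stop_antimono[of "n k" M 0 k] by force
    with ex[of M] show False by force
  qed
  then obtain k where k: "EB i k" "\<And>N. c - b i k \<le> stop 0 N $ k" by blast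
  have "k \<in> stop_bounded" unfolding stop_bounded_def using k(2) by (auto intro!: bdd_belowI2)
  moreover have "c - b i k \<le> stop_limit k"
    unfolding stop_limit_def using k(2) by (intro cINF_greatest) auto
  ultimately show "\<exists>k\<in>stop_bounded. EB i k \<and> 0 + stop_limit j + a i j \<le> b i k + stop_limit k"
    using k(1) by (intro bexI[of _ k]) (auto simp: c_def)
qed

lemma stop_eventually_small:
  "\<exists>p. \<forall>N\<ge>p. \<forall>j. j \<notin> stop_bounded \<longrightarrow> stop 0 N $ j \<le> c"
proof -
  have "\<exists>n. stop 0 n $ j \<le> c" if "j \<notin> stop_bounded" for j
  proof (rule ccontr)
    assume "\<nexists>n. stop 0 n $ j \<le> c"
    then have "c \<le> stop 0 n $ j" for n by (meson linear)
    then have "j \<in> stop_bounded" unfolding stop_bounded_def by (auto intro!: bdd_belowI2[of _ c])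
    with that show False ..
  qed
  then obtain n where n: "\<And>j. j \<notin> stop_bounded \<Longrightarrow> stop 0 (n j) $ j \<le> c" by metis
  have "n j \<le> Max (range n)" for j by (intro Max_ge) auto
  then show ?thesis
    by (intro exI[of _ "Max (range n)"]) (meson n order_trans stop_antimono)
qed

lemma payoffs_bounded:
  shows "\<exists>W\<ge>0. \<forall>i j k. \<bar>b i k - a i j\<bar> \<le> W"
proof -
  define h where "h = (\<lambda>(i, j, k). \<bar>b i k - a i j\<bar>)"
  have h: "h z \<le> Max (range h)" for z by (intro Max_ge) auto
  then have "\<bar>b i k - a i j\<bar> \<le> Max (range h)" for i j k
    by (metis (mono_tags, lifting) h_def case_prod_conv)
  moreover from this have "0 \<le> Max (range h)" by (meson abs_ge_zero order_trans)
  ultimately show ?thesis by blast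
qed

text \<open>
  On the states where \<open>stop 0\<close> is unbounded, Min can force any gain without letting Max reach
  \<open>stop_bounded\<close>. To see this, replace the stopping payment \<open>0\<close> by a large constant \<open>K\<close> on
  \<open>stop_bounded\<close>. There the subsolution \<open>stop_limit\<close>, shifted by \<open>K\<close>, keeps the values high, so that a
  move of Min that allows Max to enter \<open>stop_bounded\<close> is worse than stopping at once. Raising the
  payment costs at most \<open>K\<close>, hence the values outside still tend to \<open>-\<infinity>\<close>.
\<close>

lemma stop_confined:
  fixes T defines "T \<equiv> - stop_bounded"
  shows "\<exists>u. (\<forall>j\<in>T. u $ j = 0)
    \<and> (\<forall>N. \<forall>j\<in>T. stop u (Suc N) $ j < 0 \<longrightarrow> (\<exists>i. EA i j \<and>
          (\<forall>k. EB i k \<longrightarrow> k \<in> T \<and> b i k + stop u N $ k \<le> stop u (Suc N) $ j + a i j)))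
    \<and> (\<forall>c. \<exists>p. \<forall>N\<ge>p. \<forall>j\<in>T. stop u N $ j \<le> c)"
proof -
  obtain W where W: "W \<ge> 0" "\<And>i j k. \<bar>b i k - a i j\<bar> \<le> W" using payoffs_bounded by blast
  define D where "D = Max (range (\<lambda>j. \<bar>stop_limit j\<bar>))"
  have D: "\<bar>stop_limit j\<bar> \<le> D" for j unfolding D_def by (intro Max_ge) auto
  then have D0: "D \<ge> 0" by (meson abs_ge_zero order_trans)
  \<comment> \<open>On \<open>stop_bounded\<close> the values are at least \<open>K - D = W\<close>, which outweighs any payoff of one round.\<close>
  define K where "K = W + D"
  define u :: "real ^ 'n" where "u = (\<chi> j. if j \<in> T then 0 else K)"
  have S: "stop_limit j + K \<le> stop u N $ j" if "j \<notin> T" for j N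
    using that
  proof (induction N arbitrary: j)
    case 0
    then show ?case using stop_limit_le[of j 0] by (simp add: u_def T_def)
  next
    case (Suc N)
    have "0 + stop_limit j + K \<le> f (stop u N) $ j"
      using subsolution_stop_limit Suc by (intro subsolution_le_operator) (auto simp: T_def)
    moreover have "stop_limit j + K \<le> u $ j"
      using stop_limit_le[of j 0] Suc.prems by (simp add: u_def T_def)
    ultimately show ?case by simp
  qed
  have "\<exists>i. EA i j \<and>
          (\<forall>k. EB i k \<longrightarrow> k \<in> T \<and> b i k + stop u N $ k \<le> stop u (Suc N) $ j + a i j)"
    if "j \<in> T" and neg: "stop u (Suc N) $ j < 0" for N j
  proof -
    have eq: "stop u (Suc N) $ j = f (stop u N) $ j"
      using that by (auto simp: u_def min_def split: if_splits)
    obtain i where i: "EA i j" "\<And>k. EB i k \<Longrightarrow> b i k + stop u N $ k \<le> f (stop u N) $ j + a i j"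
      using min_move by blast
    have "k \<in> T" if "EB i k" for k
    proof (rule ccontr)
      assume "k \<notin> T"
      from S[OF this, of N] i(2)[OF that] neg W(2)[of i k j] D[of k]
      show False unfolding eq K_def by linarith
    qed
    with i show ?thesis unfolding eq by blast
  qed
  moreover have "\<exists>p. \<forall>N\<ge>p. \<forall>j\<in>T. stop u N $ j \<le> c" for c
  proof -
    obtain p where p: "\<And>N j. N \<ge> p \<Longrightarrow> j \<in> T \<Longrightarrow> stop 0 N $ j \<le> c - K"
      using stop_eventually_small[of "c - K"] unfolding T_def by blast
    have "stop u N $ j \<le> K + stop 0 N $ j" for N j
      by (rule stop_shift_mono) (use W D0 in \<open>auto simp: u_def K_def\<close>)
    with p show ?thesis by (smt (verit))
  qed
  moreover have "\<forall>j\<in>T. u $ j = 0" by (simp add: u_def)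
  ultimately show ?thesis by blast
qed

text \<open>
  Min plays rounds of the confined stopping game one after the other. A bound \<open>c\<close> for the iterates of
  \<open>f\<close> on \<open>T\<close> over a window of \<open>p\<close> steps acts as the payment at the stopping time, so after the window
  the iterates are below \<open>c\<close> plus the stopping value. Since that value is at most \<open>- (W + 1)\<close> and one
  step raises an upper bound on \<open>T\<close> by at most \<open>W\<close>, the bound \<open>c\<close> persists for ever and
  drops to \<open>c - 1\<close> after \<open>p\<close> steps.
\<close>

lemma negative_drift:
  assumes r: "r \<notin> stop_bounded"
  shows "\<exists>e>0. \<exists>C. \<forall>N. (f ^^ N) 0 $ r \<le> C - e * real N"
proof -
  define T where "T = - stop_bounded"
  define g where "g s = (f ^^ s) 0" for s
  obtain W where W: "W \<ge> 0" "\<And>i j k. \<bar>b i k - a i j\<bar> \<le> W" using payoffs_bounded by blast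
  obtain u where u0: "\<And>j. j \<in> T \<Longrightarrow> u $ j = 0"
    and move: "\<And>N j. j \<in> T \<Longrightarrow> stop u (Suc N) $ j < 0 \<Longrightarrow> \<exists>i. EA i j \<and>
          (\<forall>k. EB i k \<longrightarrow> k \<in> T \<and> b i k + stop u N $ k \<le> stop u (Suc N) $ j + a i j)"
    and small: "\<And>c. \<exists>p. \<forall>N\<ge>p. \<forall>j\<in>T. stop u N $ j \<le> c"
    using stop_confined unfolding T_def by blast
  obtain p where p: "\<And>N j. N \<ge> p \<Longrightarrow> j \<in> T \<Longrightarrow> stop u N $ j \<le> - (W + 1)"
    using small by blast
  \<comment> \<open>With no rounds left the stopping value on \<open>T\<close> is \<open>0\<close>, which is not negative enough.\<close>
  have "p \<noteq> 0" using p[of 0 r] u0[of r] r W(1) by (auto simp: T_def)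
  have one_step: "g (Suc s) $ j \<le> c + W" if "j \<in> T" and c: "\<And>k. k \<in> T \<Longrightarrow> g s $ k \<le> c" for s j c
  proof -
    have "stop u (Suc p) $ j < 0" using p[of "Suc p" j] \<open>j \<in> T\<close> W(1) by simp
    then obtain i where i: "EA i j" "\<And>k. EB i k \<Longrightarrow> k \<in> T" using move \<open>j \<in> T\<close> by blast
    obtain k where k: "EB i k" "f (g s) $ j + a i j \<le> b i k + g s $ k"
      using max_move[OF i(1)] by blast
    with c[OF i(2)[OF k(1)]] W(2)[of i k j] show ?thesis by (simp add: g_def)
  qed
  have window: "g (t + N) $ j \<le> c + stop u N $ j"
    if "j \<in> T" and c: "\<And>s k. t \<le> s \<Longrightarrow> s \<le> t + N \<Longrightarrow> k \<in> T \<Longrightarrow> g s $ k \<le> c" for t N j c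
    using that
  proof (induction N arbitrary: j)
    case 0
    then show ?case by (simp add: u0)
  next
    case (Suc N)
    show ?case
    proof (cases "stop u (Suc N) $ j < 0")
      case True
      then obtain i where i: "EA i j"
        "\<And>k. EB i k \<Longrightarrow> k \<in> T \<and> b i k + stop u N $ k \<le> stop u (Suc N) $ j + a i j"
        using move Suc.prems(1) by blast
      obtain k where k: "EB i k" "f (g (t + N)) $ j + a i j \<le> b i k + g (t + N) $ k"
        using max_move[OF i(1)] by blast
      have "g (t + N) $ k \<le> c + stop u N $ k" using i(2)[OF k(1)] Suc by auto
      with i(2)[OF k(1)] k(2) show ?thesis by (simp add: g_def)
    next
      case False
      then show ?thesis using Suc.prems(2)[of "t + Suc N" j] Suc.prems(1) by auto
    qed
  qed
  have persist: "\<forall>k\<in>T. g s $ k \<le> c"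
    if c: "\<And>s k. t \<le> s \<Longrightarrow> s \<le> t + p \<Longrightarrow> k \<in> T \<Longrightarrow> g s $ k \<le> c" and "t \<le> s" for t c s
    using \<open>t \<le> s\<close>
  proof (induction s rule: less_induct)
    case (less s)
    show ?case
    proof (cases "s \<le> t + p")
      case True
      then show ?thesis using c less.prems by blast
    next
      case False
      define N where "N = s - 1 - t"
      have N: "s = Suc (t + N)" "p \<le> N" using False by (auto simp: N_def)
      have "g (t + N) $ k \<le> c + stop u N $ k" if "k \<in> T" for k
        by (rule window[OF that]) (use less.IH N in auto)
      then have "g (t + N) $ k \<le> c - (W + 1)" if "k \<in> T" for k
        using p[OF N(2) that] that by fastforce
      from one_step[OF _ this] show ?thesis unfolding N(1) by fastforce
    qed
  qed
  have descend: "\<forall>k\<in>T. g s $ k \<le> c - 1"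
    if c: "\<And>s k. t \<le> s \<Longrightarrow> k \<in> T \<Longrightarrow> g s $ k \<le> c" and s: "t + p \<le> s" for t c s
  proof
    fix k assume k: "k \<in> T"
    have "g (t + (s - t)) $ k \<le> c + stop u (s - t) $ k" using c k by (intro window) auto
    moreover have "stop u (s - t) $ k \<le> - (W + 1)" using k s by (intro p) auto
    ultimately show "g s $ k \<le> c - 1" using s W(1) by simp
  qed
  \<comment> \<open>Since \<open>f\<^sup>s(0) \<le> s W\<close> on \<open>T\<close>, this bounds the iterates over the first window.\<close>
  define c where "c = real p * W"
  have "g s $ k \<le> real s * W" if "k \<in> T" for s k
    using that
  proof (induction s arbitrary: k)
    case (Suc s)
    then show ?case using one_step[of k s "real s * W"] by (simp add: algebra_simps)
  qed (simp add: g_def)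
  then have "g s $ k \<le> c" if "s \<le> 0 + p" "k \<in> T" for s k
    using that W(1) unfolding c_def by (smt (verit) add_0 mult_right_mono of_nat_le_iff)
  then have base: "g s $ k \<le> c" if "k \<in> T" for s k
    using persist[of 0 c s] that by blast
  have bound: "g s $ k \<le> c - real q" if "q * p \<le> s" "k \<in> T" for q s k
    using that
  proof (induction q arbitrary: s k)
    case (Suc q)
    then show ?case using descend[of "q * p" "c - real q" s] by (auto simp: algebra_simps)
  qed (use base in simp)
  have "g s $ r \<le> c + 1 - 1 / real p * real s" for s
  proof -
    have "g s $ r \<le> c - real (s div p)" using r by (intro bound) (auto simp: T_def)
    moreover have "real s / real p \<le> real (s div p) + 1"
      using floor_divide_of_nat_eq[of s p, where ?'a = real] by linarith
    ultimately show ?thesis by simp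
  qed
  with \<open>p \<noteq> 0\<close> show ?thesis unfolding g_def
    by (intro exI[of _ "1 / real p"] conjI exI[of _ "c + 1"]) auto
qed

text \<open>
  Subtracting \<open>l\<close> from the operator, or equivalently adding \<open>l\<close> to all weights \<open>a\<close>, reduces the level
  \<open>l\<close> to the level \<open>0\<close>.
\<close>

lemma game_operator_shift: "game_operator EA EB (\<lambda>i j. a i j + l) b (\<lambda>x. f x - vec l)"
proof
  show "\<exists>i. EA i j \<and> (\<forall>k. EB i k \<longrightarrow> b i k + x $ k \<le> (f x - vec l) $ j + (a i j + l))" for x j
    using min_move[of j x] by (simp add: algebra_simps)
  show "\<exists>k. EB i k \<and> (f x - vec l) $ j + (a i j + l) \<le> b i k + x $ k" if "EA i j" for x i j
    using max_move[OF that, of x] by (simp add: algebra_simps)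
qed

lemma shift_funpow: "((\<lambda>x. f x - vec l) ^^ N) 0 = (f ^^ N) 0 - vec (real N * l)"
proof (induction N)
  case (Suc N)
  then show ?case
    by (simp only: funpow.simps comp_apply operator_diff_const) (simp add: vec_eq_iff algebra_simps)
qed (simp add: vec_eq_iff)

lemma no_subsolution_upper_bound:
  assumes no: "\<nexists>S v. r \<in> S \<and> subsolution l S v"
  shows "\<exists>e>0. \<exists>C. \<forall>N. (f ^^ N) 0 $ r \<le> C + (l - e) * real N"
proof -
  interpret shifted: game_operator EA EB "\<lambda>i j. a i j + l" b "\<lambda>x. f x - vec l"
    by (rule game_operator_shift)
  have "shifted.subsolution 0 S v \<longleftrightarrow> subsolution l S v" for S v
    unfolding shifted.subsolution_def subsolution_def by (simp add: algebra_simps)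
  then have "r \<notin> shifted.stop_bounded"
    using no shifted.subsolution_stop_limit by blast
  from shifted.negative_drift[OF this] show ?thesis
    by (simp add: shift_funpow algebra_simps)
qed

section \<open>The escape rate\<close>

lemma lower_bound_imp_eventually:
  fixes z :: "nat \<Rightarrow> real"
  assumes "\<And>N. real N * l - C \<le> z N" and "m < l"
  shows "\<forall>\<^sub>F N in sequentially. m < z N / real N"
proof -
  have "(\<lambda>N. l - C / real N) \<longlonglongrightarrow> l - 0"
    by (intro tendsto_intros lim_const_over_n)
  then have "\<forall>\<^sub>F N in sequentially. m < l - C / real N"
    using assms(2) by (intro order_tendstoD) auto
  then show ?thesis using eventually_gt_at_top[of 0]
  proof eventually_elim
    case (elim N)
    have "l - C / real N \<le> z N / real N"
      using divide_right_mono[OF assms(1)[of N], of "real N"] elim(2)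
      by (simp add: diff_divide_distrib)
    with elim show ?case by simp
  qed
qed

text \<open>
  The levels of subsolutions at \<open>r\<close> form a down-set \<open>L\<close>. Levels in \<open>L\<close> bound the growth from below
  and all others bound it from above, so the growth rate is \<open>Sup L\<close>. It belongs to \<open>L\<close>, because a
  level outside \<open>L\<close> exceeds the growth rate strictly.
\<close>

lemma escape_rate_coordinate:
  "\<exists>c. (\<lambda>N. (f ^^ N) 0 $ r / real N) \<longlonglongrightarrow> c \<and>
       (\<forall>l. l \<le> c \<longleftrightarrow> (\<exists>S v. r \<in> S \<and> subsolution l S v))"
proof -
  define z where "z N = (f ^^ N) 0 $ r" for N
  define L where "L = {l. \<exists>S v. r \<in> S \<and> subsolution l S v}"
  have low: "\<forall>\<^sub>F N in sequentially. m < z N / real N" if l: "l \<in> L" "m < l" for l m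
  proof -
    obtain C where "\<And>N. real N * l - C \<le> z N"
      using l(1) subsolution_lower_bound unfolding L_def z_def by blast
    then show ?thesis using l(2) by (rule lower_bound_imp_eventually)
  qed
  have up: "\<exists>e>0. \<forall>m. l - e < m \<longrightarrow> (\<forall>\<^sub>F N in sequentially. z N / real N < m)"
    if l: "l \<notin> L" for l
  proof -
    obtain e C where e: "e > 0" and C: "\<And>N. z N \<le> C + (l - e) * real N"
      using l no_subsolution_upper_bound[of r l] unfolding L_def z_def by blast
    have "\<forall>\<^sub>F N in sequentially. z N / real N < m" if "l - e < m" for m
    proof -
      have "\<forall>\<^sub>F N in sequentially. - m < - z N / real N"
      proof (rule lower_bound_imp_eventually)
        show "real N * - (l - e) - C \<le> - z N" for N using C[of N] by (simp add: algebra_simps)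
      qed (use that in simp)
      then show ?thesis by simp
    qed
    with e show ?thesis by blast
  qed
  \<comment> \<open>The zero vector is a subsolution at the level of the worst one-step value.\<close>
  define l0 where "l0 = Min (range (\<lambda>j. f 0 $ j))"
  have l0: "l0 \<le> f 0 $ j" for j unfolding l0_def by (intro Min_le) auto
  have "subsolution l0 UNIV (\<lambda>_. 0)"
    unfolding subsolution_def
  proof (intro ballI allI impI)
    fix j i assume "EA i j"
    then obtain k where "EB i k" "f 0 $ j + a i j \<le> b i k" using max_move[of i j 0] by auto
    with l0[of j] show "\<exists>k\<in>UNIV. EB i k \<and> l0 + 0 + a i j \<le> b i k + 0"
      by (intro bexI[of _ k]) auto
  qed
  then have ne: "l0 \<in> L" unfolding L_def by blast
  have bdd: "bdd_above L"
  proof -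
    obtain W where W: "W \<ge> 0" "\<And>i j k. \<bar>b i k - a i j\<bar> \<le> W" using payoffs_bounded by blast
    have "l \<le> W" if "l \<in> L" for l
    proof -
      obtain S v where S: "r \<in> S" "subsolution l S v" using \<open>l \<in> L\<close> unfolding L_def by blast
      \<comment> \<open>From a state where \<open>v\<close> is largest, no answer of Max can increase \<open>v\<close>, so the
        level is at most the payoff of one round.\<close>
      have "Max (v ` S) \<in> v ` S" using S(1) by (intro Max_in) auto
      then obtain j where j: "j \<in> S" "v j = Max (v ` S)" by auto
      obtain i where "EA i j" using min_move by blast
      then obtain k where k: "k \<in> S" "l + v j + a i j \<le> b i k + v k"
        using S(2) j(1) unfolding subsolution_def by blast
      have "v k \<le> v j" unfolding j(2) using k(1) by (intro Max_ge) auto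
      with k(2) W(2)[of i k j] show ?thesis by simp
    qed
    then show ?thesis by (rule bdd_aboveI)
  qed
  have down: "m \<in> L" if "l \<in> L" "m \<le> l" for l m
  proof -
    obtain S v where S: "r \<in> S" "subsolution l S v" using \<open>l \<in> L\<close> unfolding L_def by blast
    have "subsolution m S v" unfolding subsolution_def
    proof (intro ballI allI impI)
      fix j i assume "j \<in> S" "EA i j"
      then obtain k where "k \<in> S" "EB i k" "l + v j + a i j \<le> b i k + v k"
        using S(2) unfolding subsolution_def by blast
      with \<open>m \<le> l\<close> show "\<exists>k\<in>S. EB i k \<and> m + v j + a i j \<le> b i k + v k"
        by (intro bexI[of _ k]) auto
    qed
    with S show ?thesis unfolding L_def by blast
  qed
  define c where "c = Sup L"
  have lim: "(\<lambda>N. z N / real N) \<longlonglongrightarrow> c"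
  proof (rule order_tendstoI)
    fix m assume "m < c"
    then obtain l where "l \<in> L" "m < l" using less_cSup_iff[OF _ bdd] ne unfolding c_def by blast
    then show "\<forall>\<^sub>F N in sequentially. m < z N / real N" by (rule low)
  next
    fix m assume "c < m"
    then have "m \<notin> L" using cSup_upper[OF _ bdd, of m] unfolding c_def by auto
    then obtain e where "e > 0" "\<And>d. m - e < d \<Longrightarrow> \<forall>\<^sub>F N in sequentially. z N / real N < d"
      using up by blast
    then show "\<forall>\<^sub>F N in sequentially. z N / real N < m" by simp
  qed
  have "l \<le> c \<longleftrightarrow> l \<in> L" for l
  proof
    assume "l \<in> L"
    then show "l \<le> c" unfolding c_def by (rule cSup_upper[OF _ bdd])
  next
    assume "l \<le> c"
    show "l \<in> L"
    proof (rule ccontr)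
      assume "l \<notin> L"
      then obtain e where e: "e > 0" "\<And>m. l - e < m \<Longrightarrow> \<forall>\<^sub>F N in sequentially. z N / real N < m"
        using up by blast
      have "c \<le> l - e / 2"
        using lim by (rule tendsto_upperbound) (use e(2)[of "l - e / 2"] e(1) in
            \<open>auto elim: eventually_mono\<close>)
      with \<open>l \<le> c\<close> e(1) show False by simp
    qed
  qed
  with lim show ?thesis unfolding z_def L_def by blast
qed

lemma escape_rate_ge_iff:
  "l \<le> escape_rate f $ r \<longleftrightarrow> (\<exists>S v. r \<in> S \<and> subsolution l S v)"
proof -
  have "\<exists>c. \<forall>j. (\<lambda>N. (f ^^ N) 0 $ j / real N) \<longlonglongrightarrow> c j \<and>
      (\<forall>l. l \<le> c j \<longleftrightarrow> (\<exists>S v. j \<in> S \<and> subsolution l S v))"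
    by (intro choice allI escape_rate_coordinate)
  then obtain c where c: "\<forall>j. (\<lambda>N. (f ^^ N) 0 $ j / real N) \<longlonglongrightarrow> c j \<and>
      (\<forall>l. l \<le> c j \<longleftrightarrow> (\<exists>S v. j \<in> S \<and> subsolution l S v))" ..
  have "(\<lambda>N. (1 / real N) *\<^sub>R (f ^^ N) 0) \<longlonglongrightarrow> (\<chi> j. c j)"
    using c by (intro vec_tendstoI) simp
  then have "escape_rate f = (\<chi> j. c j)" unfolding escape_rate_def by (rule limI)
  with c show ?thesis by simp
qed

end

section \<open>Tropical linear inequalities\<close>

text \<open>
  The separate terms \<open>A\<^sub>i\<^sub>r\<close> and \<open>B\<^sub>i\<^sub>r\<close> of the polyhedron homogenise it: they are the terms of
  coordinate \<open>r\<close> when that coordinate is \<open>0\<close>.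
\<close>

lemma SUP_insert_coordinate:
  fixes R :: "'n::finite \<Rightarrow> ereal"
  shows "max (SUP j \<in> - {r}. R j + y j) (R r) = (SUP j. R j + (y(r := 0)) j)"
proof -
  have "(SUP j. R j + (y(r := 0)) j) = (SUP j\<in>insert r (- {r}). R j + (y(r := 0)) j)"
    by (rule arg_cong[where f = Sup]) auto
  also have "\<dots> = sup (R r) (SUP j\<in>- {r}. R j + y j)" by simp
  finally show ?thesis by (simp only: sup_max max.commute)
qed

lemma tropical_inequality_iff:
  fixes R Q y :: "'n::finite \<Rightarrow> ereal"
  shows "ereal l + (SUP j. R j + y j) \<le> (SUP k. Q k + y k) \<longleftrightarrow>
    (\<forall>j. \<exists>k. ereal l + (R j + y j) \<le> Q k + y k)" (is "?lhs \<longleftrightarrow> ?rhs")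
proof
  assume ?lhs
  have "(SUP k. Q k + y k) \<in> range (\<lambda>k. Q k + y k)"
    by (subst cSup_eq_Max) (auto intro!: Max_in)
  then obtain k where k: "(SUP k. Q k + y k) = Q k + y k" by auto
  have "ereal l + (R j + y j) \<le> Q k + y k" for j
  proof -
    have "R j + y j \<le> (SUP j. R j + y j)" by (rule SUP_upper) simp
    then have "ereal l + (R j + y j) \<le> ereal l + (SUP j. R j + y j)" by (rule add_left_mono)
    also note \<open>?lhs\<close>
    finally show ?thesis by (simp add: k)
  qed
  then show ?rhs by blast
next
  assume ?rhs
  have "(SUP j. R j + y j) \<in> range (\<lambda>j. R j + y j)"
    by (subst cSup_eq_Max) (auto intro!: Max_in)
  then obtain j where j: "(SUP j. R j + y j) = R j + y j" by auto
  obtain k where "ereal l + (R j + y j) \<le> Q k + y k" using \<open>?rhs\<close> by blast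
  also have "\<dots> \<le> (SUP k. Q k + y k)" by (rule SUP_upper) simp
  finally show ?lhs by (simp add: j)
qed

text \<open>
  The value of \<open>f\<close> is finite and extrema over finite index types are attained, so neither the optimal
  \<open>i\<close>, where a missing entry of \<open>A\<close> contributes \<open>\<infinity>\<close>, nor the optimal \<open>k\<close>, where a missing entry of
  \<open>B\<close> contributes \<open>-\<infinity>\<close>, can sit at a missing entry.
\<close>

lemma game_operator_dp_op:
  fixes A B :: "ereal ^ 'n ^ 'm"
  assumes A: "\<And>i j. A $ i $ j \<in> trop" and B: "\<And>i j. B $ i $ j \<in> trop"
    and colA: "\<And>j. \<exists>i. A $ i $ j \<noteq> -\<infinity>" and rowB: "\<And>i. \<exists>j. B $ i $ j \<noteq> -\<infinity>"
  shows "game_operator (\<lambda>i j. A $ i $ j \<noteq> -\<infinity>) (\<lambda>i j. B $ i $ j \<noteq> -\<infinity>)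
    (\<lambda>i j. real_of_ereal (A $ i $ j)) (\<lambda>i j. real_of_ereal (B $ i $ j)) (dp_op A B)"
proof
  let ?s = "\<lambda>x i. SUP k. B $ i $ k + ereal (x $ k)"
  let ?g = "\<lambda>x j i. - (A $ i $ j) + ?s x i"
  have f: "ereal (dp_op A B x $ j) = (INF i. ?g x j i)" for x j
    by (rule ereal_dp_op[OF A B colA rowB])
  {
    fix j :: 'n and x :: "real ^ 'n"
    have "(INF i. ?g x j i) \<in> range (?g x j)"
      by (subst cInf_eq_Min) (auto intro!: Min_in)
    then obtain i where i: "ereal (dp_op A B x $ j) = ?g x j i" using f[of x j] by auto
    have Ai: "A $ i $ j \<noteq> -\<infinity>" using i by auto
    have "real_of_ereal (B $ i $ k) + x $ k \<le> dp_op A B x $ j + real_of_ereal (A $ i $ j)"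
      if "B $ i $ k \<noteq> -\<infinity>" for k
    proof -
      have "B $ i $ k + ereal (x $ k) \<le> ?s x i" by (rule SUP_upper) simp
      then show ?thesis
        using i Ai that A[of i j] B[of i k]
        by (cases "A $ i $ j"; cases "B $ i $ k"; cases "?s x i") (auto simp: trop_def)
    qed
    with Ai show "\<exists>i. A $ i $ j \<noteq> -\<infinity> \<and> (\<forall>k. B $ i $ k \<noteq> -\<infinity> \<longrightarrow>
        real_of_ereal (B $ i $ k) + x $ k \<le> dp_op A B x $ j + real_of_ereal (A $ i $ j))"
      by blast
  }
  fix i :: 'm and j :: 'n and x :: "real ^ 'n"
  assume Ai: "A $ i $ j \<noteq> -\<infinity>"
  have "?s x i \<in> range (\<lambda>k. B $ i $ k + ereal (x $ k))"
    by (subst cSup_eq_Max) (auto intro!: Max_in)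
  then obtain k where k: "?s x i = B $ i $ k + ereal (x $ k)" by auto
  have "ereal (dp_op A B x $ j) \<le> ?g x j i" unfolding f by (rule INF_lower) simp
  then have "B $ i $ k \<noteq> -\<infinity> \<and>
      dp_op A B x $ j + real_of_ereal (A $ i $ j) \<le> real_of_ereal (B $ i $ k) + x $ k"
    unfolding k using Ai A[of i j] B[of i k]
    by (cases "A $ i $ j"; cases "B $ i $ k") (auto simp: trop_def)
  then show "\<exists>k. B $ i $ k \<noteq> -\<infinity> \<and>
      dp_op A B x $ j + real_of_ereal (A $ i $ j) \<le> real_of_ereal (B $ i $ k) + x $ k"
    by blast
qed

text \<open>
  A subsolution whose support contains \<open>r\<close> is normalised to vanish at \<open>r\<close> by subtracting \<open>v r\<close>.
  Conversely, the finite part of a point of the polyhedron is a subsolution: an inequality with a finite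
  left-hand side can only be met by a finite term on the right.
\<close>

lemma trop_polyhedron_nonempty_iff:
  fixes A B :: "ereal ^ 'n ^ 'm"
  assumes A: "\<And>i j. A $ i $ j \<in> trop" and B: "\<And>i j. B $ i $ j \<in> trop"
    and colA: "\<And>j. \<exists>i. A $ i $ j \<noteq> -\<infinity>" and rowB: "\<And>i. \<exists>j. B $ i $ j \<noteq> -\<infinity>"
  shows "trop_polyhedron A B l r \<noteq> {} \<longleftrightarrow>
    (\<exists>S v. r \<in> S \<and> game_operator.subsolution (\<lambda>i j. A $ i $ j \<noteq> -\<infinity>) (\<lambda>i j. B $ i $ j \<noteq> -\<infinity>)
      (\<lambda>i j. real_of_ereal (A $ i $ j)) (\<lambda>i j. real_of_ereal (B $ i $ j)) l S v)"
proof -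
  interpret game_operator "\<lambda>i j. A $ i $ j \<noteq> -\<infinity>" "\<lambda>i j. B $ i $ j \<noteq> -\<infinity>"
    "\<lambda>i j. real_of_ereal (A $ i $ j)" "\<lambda>i j. real_of_ereal (B $ i $ j)" "dp_op A B"
    by (rule game_operator_dp_op[OF assms])
  have mem: "y \<in> trop_polyhedron A B l r \<longleftrightarrow> y \<in> (- {r}) \<rightarrow>\<^sub>E trop \<and>
      (\<forall>i j. \<exists>k. ereal l + (A $ i $ j + (y(r := 0)) j) \<le> B $ i $ k + (y(r := 0)) k)" for y
    unfolding trop_polyhedron_def SUP_insert_coordinate tropical_inequality_iff by simp
  show ?thesis
  proof
    assume "trop_polyhedron A B l r \<noteq> {}"
    then obtain y where "y \<in> trop_polyhedron A B l r" by blast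
    define w where "w = y(r := 0)"
    have w: "w j \<in> trop" for j
      using \<open>y \<in> _\<close> unfolding mem w_def by (auto simp: trop_def PiE_def Pi_def)
    have le: "\<exists>k. ereal l + (A $ i $ j + w j) \<le> B $ i $ k + w k" for i j
      using \<open>y \<in> _\<close> unfolding mem w_def by blast
    have "subsolution l {j. w j \<noteq> -\<infinity>} (\<lambda>j. real_of_ereal (w j))"
      unfolding subsolution_def
    proof (intro ballI allI impI)
      fix j i assume j: "j \<in> {j. w j \<noteq> -\<infinity>}" and i: "A $ i $ j \<noteq> -\<infinity>"
      obtain k where k: "ereal l + (A $ i $ j + w j) \<le> B $ i $ k + w k" using le by blast
      have "w k \<noteq> -\<infinity> \<and> B $ i $ k \<noteq> -\<infinity> \<and> l + real_of_ereal (w j) + real_of_ereal (A $ i $ j)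
        \<le> real_of_ereal (B $ i $ k) + real_of_ereal (w k)"
        using j i k w[of j] w[of k] A[of i j] B[of i k]
        by (cases "w j"; cases "w k"; cases "A $ i $ j"; cases "B $ i $ k") (auto simp: trop_def)
      then show "\<exists>k\<in>{j. w j \<noteq> -\<infinity>}. B $ i $ k \<noteq> -\<infinity> \<and>
          l + real_of_ereal (w j) + real_of_ereal (A $ i $ j)
            \<le> real_of_ereal (B $ i $ k) + real_of_ereal (w k)" by blast
    qed
    moreover have "r \<in> {j. w j \<noteq> -\<infinity>}" by (simp add: w_def)
    ultimately show "\<exists>S v. r \<in> S \<and> subsolution l S v" by (intro exI conjI)
  next
    assume "\<exists>S v. r \<in> S \<and> subsolution l S v"
    then obtain S v where S: "r \<in> S" "subsolution l S v" by blast
    define w where "w j = (if j \<in> S then ereal (v j - v r) else -\<infinity>)" for j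
    define y where "y = restrict w (- {r})"
    have y: "(y(r := 0)) j = w j" for j using S(1) by (simp add: y_def w_def)
    have "\<exists>k. ereal l + (A $ i $ j + w j) \<le> B $ i $ k + w k" for i j
    proof (cases "j \<in> S \<and> A $ i $ j \<noteq> -\<infinity>")
      case True
      then obtain k where "k \<in> S" "B $ i $ k \<noteq> -\<infinity>"
        "l + v j + real_of_ereal (A $ i $ j) \<le> real_of_ereal (B $ i $ k) + v k"
        using S(2) unfolding subsolution_def by blast
      then have "ereal l + (A $ i $ j + w j) \<le> B $ i $ k + w k"
        using True A[of i j] B[of i k]
        by (cases "A $ i $ j"; cases "B $ i $ k") (auto simp: trop_def w_def)
      then show ?thesis ..
    next
      case False
      then have "A $ i $ j + w j = -\<infinity>"
        using A[of i j] by (cases "A $ i $ j") (auto simp: trop_def w_def)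
      then show ?thesis by (metis ereal_less_eq(2) plus_ereal.simps(4))
    qed
    then have "y \<in> trop_polyhedron A B l r"
      unfolding mem y by (auto simp: y_def w_def trop_def)
    then show "trop_polyhedron A B l r \<noteq> {}" by blast
  qed
qed

theorem theorem3p6:
  fixes A B :: "ereal ^ 'n ^ 'm" and r :: 'n and l :: real
  assumes "\<And>i j. A $ i $ j \<in> trop" and "\<And>i j. B $ i $ j \<in> trop"
    and "\<And>j. \<exists>i. A $ i $ j \<noteq> -\<infinity>" and "\<And>i. \<exists>j. B $ i $ j \<noteq> -\<infinity>"
  shows "escape_rate (dp_op A B) $ r \<ge> l \<longleftrightarrow> trop_polyhedron A B l r \<noteq> {}"
  unfolding trop_polyhedron_nonempty_iff[OF assms]
  by (rule game_operator.escape_rate_ge_iff[OF game_operator_dp_op[OF assms]])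

end
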